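(* Let $X\in M_2(\mathbb{N}_0)^\bullet$ be a doubly-balanced matrix with relatively prime adjacent entries. If $|\det(X)|=16$ or $|\det(X)|=32$, then $X$ is an atom of $M_2(\mathbb{N}_0)^\bullet$.
   Context: $M_2(\mathbb{N}_0)^\bullet$ is the semigroup, under matrix multiplication, of $2\times 2$ matrices with non-negative integer entries and non-zero determinant. Its only units are $I=\begin{pmatrix}1&0\\0&1\end{pmatrix}$ and $J=\begin{pmatrix}0&1\\1&0\end{pmatrix}$. An atom is a non-unit $X\in M_2(\mathbb{N}_0)^\bullet$ such that whenever $X=AB$ with $A,B\in M_2(\mathbb{N}_0)^\bullet$, at least one of $A,B$ is a unit. A row of a $2\times2$ matrix is dominant if both of its entries are greater than or equal to the corresponding entries of the other row; a column is dominant if both of its entries are greater than or equal to the corresponding entries of the other column. A matrix is row-balanced if neither row is dominant, column-balanced if neither column is dominant, and doubly-balanced if it is both row- and column-balanced. A matrix $\begin{pmatrix}w&x\\ y&z\end{pmatrix}$ has relatively prime adjacent entries if the two entries of each row are relatively prime and the two entries of each column are relatively prime; equivalently, $\gcd(wz,xy)=1$. *)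

theory Defs
  imports "HOL-Analysis.Analysis" "HOL-Algebra.Group"
begin

(* The library determinant needs a commutative ring, hence the passage to int. *)
definition idet :: "nat^2^2 \<Rightarrow> int" where
  "idet X = det (map_matrix int X)"

definition M2N :: "(nat^2^2) monoid" where
  "M2N = \<lparr>carrier = {X. idet X \<noteq> 0}, mult = (**), one = mat 1\<rparr>"

(* The usual notion of an atom of a (possibly non-commutative) monoid. The irreducible elements
   of HOL-Algebra.Divisibility are defined through one-sided proper factors instead. *)
definition is_atom :: "('a, 'b) monoid_scheme \<Rightarrow> 'a \<Rightarrow> bool" where
  "is_atom G X \<longleftrightarrow> X \<in> carrier G \<and> X \<notin> Units G \<and>
     (\<forall>A\<in>carrier G. \<forall>B\<in>carrier G. X = A \<otimes>\<^bsub>G\<^esub> B \<longrightarrow> A \<in> Units G \<or> B \<in> Units G)"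

definition dominant_row :: "nat^2^2 \<Rightarrow> 2 \<Rightarrow> bool" where
  "dominant_row X i \<longleftrightarrow> (\<forall>i'. i' \<noteq> i \<longrightarrow> (\<forall>j. X $ i $ j \<ge> X $ i' $ j))"

definition dominant_column :: "nat^2^2 \<Rightarrow> 2 \<Rightarrow> bool" where
  "dominant_column X j \<longleftrightarrow> (\<forall>j'. j' \<noteq> j \<longrightarrow> (\<forall>i. X $ i $ j \<ge> X $ i $ j'))"

definition row_balanced :: "nat^2^2 \<Rightarrow> bool" where
  "row_balanced X \<longleftrightarrow> (\<forall>i. \<not> dominant_row X i)"

definition column_balanced :: "nat^2^2 \<Rightarrow> bool" where
  "column_balanced X \<longleftrightarrow> (\<forall>j. \<not> dominant_column X j)"

definition doubly_balanced :: "nat^2^2 \<Rightarrow> bool" where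
  "doubly_balanced X \<longleftrightarrow> row_balanced X \<and> column_balanced X"

definition coprime_adjacent :: "nat^2^2 \<Rightarrow> bool" where
  "coprime_adjacent X \<longleftrightarrow>
     (\<forall>i. coprime (X $ i $ 1) (X $ i $ 2)) \<and> (\<forall>j. coprime (X $ 1 $ j) (X $ 2 $ j))"

lemma idet_2: "idet X = int (X$1$1) * int (X$2$2) - int (X$1$2) * int (X$2$1)"
  by (simp add: idet_def det_2)

lemma idet_mult: "idet (A ** B) = idet A * idet B"
  by (simp add: idet_2 matrix_matrix_mult_def sum_2 algebra_simps)

lemma idet_one: "idet (mat 1) = 1"
  by (simp add: idet_2 mat_def)

lemma monoid_M2N: "monoid M2N"
  by (rule monoidI) (auto simp: M2N_def idet_mult idet_one matrix_mul_assoc simp del: One_nat_def)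

lemma mat2_eq_iff:
  fixes X Y :: "'a^2^2"
  shows "X = Y \<longleftrightarrow> X$1$1 = Y$1$1 \<and> X$1$2 = Y$1$2 \<and> X$2$1 = Y$2$1 \<and> X$2$2 = Y$2$2"
  by (auto simp: vec_eq_iff forall_2)

lemma Units_M2N: "Units M2N = {mat 1, vector [vector [0, 1], vector [1, 0]]}"
proof (intro equalityI subsetI)
  fix Y assume "Y \<in> Units M2N"
  then obtain X where X: "X ** Y = mat 1" "Y ** X = mat 1"
    by (auto simp: Units_def M2N_def)
  have "X$1$1 * Y$1$1 + X$1$2 * Y$2$1 = 1" "X$1$1 * Y$1$2 + X$1$2 * Y$2$2 = 0"
    "X$2$1 * Y$1$1 + X$2$2 * Y$2$1 = 0" "X$2$1 * Y$1$2 + X$2$2 * Y$2$2 = 1"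
    "Y$1$1 * X$1$1 + Y$1$2 * X$2$1 = 1" "Y$1$1 * X$1$2 + Y$1$2 * X$2$2 = 0"
    "Y$2$1 * X$1$1 + Y$2$2 * X$2$1 = 0" "Y$2$1 * X$1$2 + Y$2$2 * X$2$2 = 1"
    using X by (simp_all add: mat2_eq_iff matrix_matrix_mult_def sum_2 mat_def)
  then have "Y$1$1 = 1 \<and> Y$1$2 = 0 \<and> Y$2$1 = 0 \<and> Y$2$2 = 1 \<or>
      Y$1$1 = 0 \<and> Y$1$2 = 1 \<and> Y$2$1 = 1 \<and> Y$2$2 = 0"
    unfolding add_is_0 add_is_1 mult_is_0 One_nat_def nat_mult_eq_1_iff mult_eq_1_iff
    by (metis zero_neq_one One_nat_def)
  then show "Y \<in> {mat 1, vector [vector [0, 1], vector [1, 0]]}"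
    by (simp add: mat2_eq_iff mat_def)
next
  fix Y :: "nat^2^2" assume "Y \<in> {mat 1, vector [vector [0, 1], vector [1, 0]]}"
  then have "Y ** Y = mat 1" "idet Y \<noteq> 0"
    by (auto simp: mat2_eq_iff matrix_matrix_mult_def sum_2 mat_def idet_2)
  then show "Y \<in> Units M2N"
    by (auto simp: Units_def M2N_def)
qed

end

theory Submission
  imports Defs
begin

text \<open>
  In a factorization \<open>X = A B\<close>, a dominant row of \<open>A\<close> would be inherited by \<open>X\<close>, and so would a
  row of \<open>A\<close> with only even entries. Hence \<open>A\<close> is row-balanced and, because coprime adjacent
  entries and an even determinant force all entries of \<open>X\<close> to be odd, each row of \<open>A\<close> contains
  an odd entry. Being row-balanced makes the determinant large: up to exchanging the columns,
  \<open>A\<close> has rows \<open>(c + s, b)\<close> and \<open>(c, b + t)\<close> with \<open>s, t > 0\<close>, and its determinant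
  \<open>c t + s b + s t\<close> is a sum of non-negative terms.

  Since the determinant of \<open>A\<close> divides a power of two, it is \<open>\<plusminus>1\<close> or even. If it is \<open>\<plusminus>1\<close>, then
  \<open>s = t = 1\<close> and \<open>b = c = 0\<close>, so \<open>A\<close> is a unit. If it is even, then the two rows of \<open>A\<close> are
  linearly dependent and non-zero modulo 2, hence equal modulo 2; so \<open>s\<close> and \<open>t\<close> are even, and
  \<open>b\<close>, \<open>c\<close> are not both 0, which gives a determinant of absolute value at least
  \<open>2 (b + c) + 4 \<ge> 6\<close>. The same holds for \<open>B\<close> by transposition. Thus a product of two non-units
  would have a determinant of absolute value at least 36, which exceeds 32.
\<close>

lemma row_balanced_cases:
  assumes "row_balanced A"
  obtains "A$1$1 > A$2$1" "A$2$2 > A$1$2" | "A$1$2 > A$2$2" "A$2$1 > A$1$1"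
proof -
  have "\<not> (A$1$1 \<ge> A$2$1 \<and> A$1$2 \<ge> A$2$2)" "\<not> (A$2$1 \<ge> A$1$1 \<and> A$2$2 \<ge> A$1$2)"
    using assms by (auto simp: row_balanced_def dominant_row_def forall_2)
  then show ?thesis
    using that by linarith
qed

lemma dominant_row_mult: "dominant_row A i \<Longrightarrow> dominant_row (A ** B) i"
  unfolding dominant_row_def matrix_matrix_mult_def by (auto intro!: sum_mono mult_right_mono)

lemma row_balanced_left_factor: "row_balanced (A ** B) \<Longrightarrow> row_balanced A"
  unfolding row_balanced_def using dominant_row_mult by blast

lemma exists_2: "(\<exists>i::2. P i) \<longleftrightarrow> P 1 \<or> P 2"
  using forall_2[of "\<lambda>i. \<not> P i"] by blast

lemma odd_in_row_left_factor:
  fixes A B :: "nat^2^2"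
  assumes "odd ((A ** B) $ i $ j)"
  shows "\<exists>k. odd (A $ i $ k)"
  using assms by (auto simp: matrix_matrix_mult_def sum_2)

lemma det_of_dominant_diagonal:
  fixes b c s t :: int
  shows "(c + s) * (b + t) - b * c = c * t + s * b + s * t"
  by (simp add: algebra_simps)

lemma dominant_diagonal_det_1:
  fixes a b c d :: nat
  assumes "c < a" "b < d" "int a * int d - int b * int c = 1"
  shows "a = 1 \<and> b = 0 \<and> c = 0 \<and> d = 1"
proof -
  define s t where "s = a - c" and "t = d - b"
  have st: "a = c + s" "d = b + t" "s \<ge> 1" "t \<ge> 1"
    using assms by (auto simp: s_def t_def)
  have "int (c * t + s * b + s * t) = 1"
    using assms(3) det_of_dominant_diagonal[of "int c" "int s" "int b" "int t"] by (simp add: st)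
  then have "c * t + s * b + s * t = 1"
    by linarith
  moreover have "s * t \<ge> 1"
    using st by simp
  ultimately have "c * t = 0" "s * b = 0" "s * t = 1"
    by linarith+
  then show ?thesis
    using st by auto
qed

text \<open>
  Modulo 2, two dependent non-zero vectors are equal, so \<open>a - c\<close> and \<open>d - b\<close> are even and thus
  at least 2. Were \<open>b = c = 0\<close>, then \<open>a\<close> would be even and \<open>(a, b)\<close> would vanish modulo 2.
\<close>
lemma dominant_diagonal_even_det_ge_6:
  fixes a b c d :: nat
  assumes "c < a" "b < d" "even (int a * int d - int b * int c)"
    and "odd a \<or> odd b" "odd c \<or> odd d"
  shows "int a * int d - int b * int c \<ge> 6"
proof -
  define s t where "s = a - c" and "t = d - b"
  have ad: "a = c + s" "d = b + t" "s > 0" "t > 0"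
    using assms by (auto simp: s_def t_def)
  have "even s" "even t"
    using assms(3-5) by (auto simp: ad)
  then have st: "s \<ge> 2" "t \<ge> 2"
    using ad by (auto elim!: evenE)
  have bc: "b + c \<ge> 1"
    using assms(4) \<open>even s\<close> by (auto simp: ad dest: odd_pos)
  have "c * 2 \<le> c * t" "2 * b \<le> s * b" "2 * 2 \<le> s * t"
    by (rule mult_le_mono st order_refl)+
  then have "6 \<le> c * t + s * b + s * t"
    using bc by linarith
  then have "6 \<le> int (c * t + s * b + s * t)"
    by linarith
  then show ?thesis
    using det_of_dominant_diagonal[of "int c" "int s" "int b" "int t"] by (simp add: ad)
qed

lemma row_balanced_abs_idet_1_imp_unit:
  assumes "row_balanced A" "\<bar>idet A\<bar> = 1"
  shows "A \<in> Units M2N"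
  using assms(1)
proof (cases rule: row_balanced_cases)
  case 1
  then have "A$1$2 * A$2$1 \<le> A$1$1 * A$2$2"
    by (subst mult.commute) (intro mult_le_mono, auto)
  then have "idet A \<ge> 0"
    by (simp add: idet_2 flip: of_nat_mult)
  then show ?thesis
    using dominant_diagonal_det_1[OF 1] assms(2) by (simp add: idet_2 Units_M2N mat2_eq_iff mat_def)
next
  case 2
  then have "A$1$1 * A$2$2 \<le> A$1$2 * A$2$1"
    by (subst mult.commute) (intro mult_le_mono, auto)
  then have "idet A \<le> 0"
    by (simp add: idet_2 flip: of_nat_mult)
  then show ?thesis
    using dominant_diagonal_det_1[OF 2(2,1)] assms(2)
    by (simp add: idet_2 Units_M2N mat2_eq_iff mat_def mult.commute)
qed

lemma row_balanced_even_idet_ge_6: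
  assumes "row_balanced A" "even (idet A)" "\<And>i. \<exists>k. odd (A $ i $ k)"
  shows "\<bar>idet A\<bar> \<ge> 6"
proof -
  have rows: "odd (A$1$1) \<or> odd (A$1$2)" "odd (A$2$1) \<or> odd (A$2$2)"
    using assms(3)[of 1] assms(3)[of 2] by (simp_all only: exists_2)
  from assms(1) show ?thesis
  proof (cases rule: row_balanced_cases)
    case 1
    then have "idet A \<ge> 6"
      using dominant_diagonal_even_det_ge_6[OF 1] assms(2) rows unfolding idet_2 by blast
    then show ?thesis
      by linarith
  next
    case 2
    have neg: "int (A$1$2) * int (A$2$1) - int (A$1$1) * int (A$2$2) = - idet A"
      by (simp add: idet_2)
    have "- idet A \<ge> 6"
    proof -
      have "even (- idet A)"
        using assms(2) by simp
      then show ?thesis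
        using dominant_diagonal_even_det_ge_6[OF 2] rows unfolding neg by blast
    qed
    then show ?thesis
      by linarith
  qed
qed

text \<open>
  The determinant being a divisor of a power of two leaves only the two cases treated above:
  an odd one is \<open>\<plusminus>1\<close> and belongs to a unit.
\<close>
lemma nonunit_left_factor_idet_ge_6:
  assumes "row_balanced (A ** B)" "\<And>i j. odd ((A ** B) $ i $ j)"
    and "idet (A ** B) dvd 2 ^ n" "A \<notin> Units M2N"
  shows "\<bar>idet A\<bar> \<ge> 6"
proof (rule row_balanced_even_idet_ge_6)
  show bal: "row_balanced A"
    using assms(1) by (rule row_balanced_left_factor)
  show "\<exists>k. odd (A $ i $ k)" for i
    using assms(2)[of i 1] by (rule odd_in_row_left_factor)
  show "even (idet A)"
  proof (rule ccontr)
    assume "odd (idet A)"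
    then have "coprime (idet A) (2 ^ n)"
      by simp
    moreover have "idet A dvd 2 ^ n"
      using assms(3) by (auto simp: idet_mult intro: dvd_mult_left)
    ultimately have "is_unit (idet A)"
      by (metis coprime_common_divisor dvd_refl)
    then show False
      using row_balanced_abs_idet_1_imp_unit[OF bal] assms(4) by simp
  qed
qed

lemma coprime_adjacent_even_idet_imp_odd:
  assumes "coprime_adjacent X" "even (idet X)"
  shows "odd (X $ i $ j)"
proof -
  have not_both: "odd m \<or> odd n" if "coprime m n" for m n :: nat
    using coprime_common_divisor[OF that, of 2] by (metis odd_one)
  have "\<forall>i. odd (X$i$1) \<or> odd (X$i$2)" "\<forall>j. odd (X$1$j) \<or> odd (X$2$j)"
    using assms(1) not_both unfolding coprime_adjacent_def by blast+
  moreover have "even (X$1$1 * X$2$2) \<longleftrightarrow> even (X$1$2 * X$2$1)"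
    using assms(2) by (simp add: idet_2)
  ultimately have "\<forall>i j. odd (X $ i $ j)"
    unfolding forall_2 even_mult_iff by argo
  then show ?thesis
    by blast
qed

lemma idet_transpose: "idet (transpose A) = idet A"
  by (simp add: idet_2 transpose_def mult.commute)

lemma row_balanced_transpose: "row_balanced (transpose X) \<longleftrightarrow> column_balanced X"
  by (simp add: row_balanced_def column_balanced_def dominant_row_def dominant_column_def
      transpose_def)

lemma Units_transpose: "transpose A \<in> Units M2N \<longleftrightarrow> A \<in> Units M2N"
  by (auto simp: Units_M2N mat2_eq_iff mat_def transpose_def)

lemma nonunit_right_factor_idet_ge_6:
  assumes "column_balanced (A ** B)" "\<And>i j. odd ((A ** B) $ i $ j)"
    and "idet (A ** B) dvd 2 ^ n" "B \<notin> Units M2N"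
  shows "\<bar>idet B\<bar> \<ge> 6"
proof -
  have eq: "transpose B ** transpose A = transpose (A ** B)"
    by (simp add: matrix_transpose_mul)
  have "\<bar>idet (transpose B)\<bar> \<ge> 6"
  proof (rule nonunit_left_factor_idet_ge_6)
    show "odd ((transpose B ** transpose A) $ i $ j)" for i j
      unfolding eq using assms(2) by (simp add: transpose_def)
  qed (use assms in \<open>simp_all only: eq row_balanced_transpose idet_transpose Units_transpose, simp_all\<close>)
  then show ?thesis
    by (simp add: idet_transpose)
qed

theorem theorem4p4:
  fixes X :: "nat^2^2"
  assumes "X \<in> carrier M2N"
    and "doubly_balanced X"
    and "coprime_adjacent X"
    and "\<bar>idet X\<bar> = 16 \<or> \<bar>idet X\<bar> = 32"
  shows "is_atom M2N X"
proof -
  have "idet X \<in> {16, - 16, 32, - 32}"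
    using assms(4) by auto
  then have "idet X dvd 2 ^ 5"
    by auto
  have "even (idet X)"
    using assms(4) by presburger
  then have odd: "odd (X $ i $ j)" for i j
    using assms(3) coprime_adjacent_even_idet_imp_odd by blast
  have "X \<notin> Units M2N"
    using assms(4) by (auto simp: Units_M2N idet_2 mat_def)
  moreover have "A \<in> Units M2N \<or> B \<in> Units M2N" if X: "X = A ** B" for A B
  proof (rule ccontr)
    assume "\<not> (A \<in> Units M2N \<or> B \<in> Units M2N)"
    then have "\<bar>idet A\<bar> \<ge> 6" "\<bar>idet B\<bar> \<ge> 6"
      using nonunit_left_factor_idet_ge_6[of A B 5] nonunit_right_factor_idet_ge_6[of A B 5]
        assms(2) odd \<open>idet X dvd 2 ^ 5\<close> unfolding X doubly_balanced_def by blast+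
    then have "6 * 6 \<le> \<bar>idet A\<bar> * \<bar>idet B\<bar>"
      by (intro mult_mono) auto
    then show False
      using assms(4) by (simp add: X idet_mult abs_mult)
  qed
  ultimately show ?thesis
    using assms(1) by (auto simp: is_atom_def M2N_def)
qed

end
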